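(* Let $d\ge 1$ be an integer. The $l_0$ pseudonorm $\ell_0$ coincides, on the Euclidean unit sphere $S=\{x\in\mathbb{R}^d:\|x\|=1\}$, with a convex lower semicontinuous function defined on the whole space $\mathbb{R}^d$, namely $$\ell_0(x)=\Big(\sup_{l=0,1,\ldots,d}\big[\|\cdot\|_{(l)}^{\mathrm{sgn}}-l\big]\Big)^{\star}(x),\qquad\forall x\in S,$$ where $\star$ denotes the Fenchel conjugate.
   Context: $\mathbb{R}^d$ carries the standard scalar product $\langle\cdot,\cdot\rangle$ and the Euclidean norm $\|\cdot\|$. $\ell_0(x)$ is the number of nonzero components of $x\in\mathbb{R}^d$. For $K\subset\{1,\ldots,d\}$ and $x\in\mathbb{R}^d$, $x_K\in\mathbb{R}^d$ is the vector with the same components as $x$ for indices in $K$ and zero components outside $K$. For $l\in\{1,\ldots,d\}$, $\|x\|_{(l)}^{\mathrm{sgn}}=\sup_{K\subset\{1,\ldots,d\},\,|K|\le l}\|x_K\|$, and by convention $\|\cdot\|_{(0)}^{\mathrm{sgn}}=0$. The Fenchel conjugate of $g:\mathbb{R}^d\to[-\infty,+\infty]$ is $g^{\star}(x)=\sup_{y\in\mathbb{R}^d}\big(\langle x,y\rangle-g(y)\big)$, a function $\mathbb{R}^d\to[-\infty,+\infty]$. *)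

theory Defs
  imports "HOL-Analysis.Analysis"
begin

definition l0 :: "real^'n \<Rightarrow> nat" where
  "l0 x = card {i. x $ i \<noteq> 0}"

definition restrict_to :: "'n set \<Rightarrow> real^'n \<Rightarrow> real^'n" where
  "restrict_to K x = (\<chi> i. if i \<in> K then x $ i else 0)"

(* Only indices l up to the dimension are meaningful. The supremum is over a finite
   nonempty set of reals, so it is a genuine maximum. *)
definition sgn_norm :: "nat \<Rightarrow> real^'n \<Rightarrow> real" where
  "sgn_norm l x =
     (if l = 0 then 0 else (SUP K\<in>{K. card K \<le> l}. norm (restrict_to K x)))"

(* The minuend is always finite, so no undetermined difference of infinities occurs. *)
definition fenchel_conjugate :: "('a::real_inner \<Rightarrow> ereal) \<Rightarrow> 'a \<Rightarrow> ereal" where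
  "fenchel_conjugate g x = (SUP y. ereal (x \<bullet> y) - g y)"

(* Convexity through the epigraph in 'a * real, which also makes sense for functions
   taking both infinite values; the library's convex_on covers only real-valued ones. *)
definition convex_ereal :: "('a::real_vector \<Rightarrow> ereal) \<Rightarrow> bool" where
  "convex_ereal f \<longleftrightarrow> convex {(x, t::real). f x \<le> ereal t}"

definition lower_semicontinuous :: "('a::topological_space \<Rightarrow> ereal) \<Rightarrow> bool" where
  "lower_semicontinuous f \<longleftrightarrow> (\<forall>x. f x \<le> Liminf (at x) f)"

end

theory Submission
  imports Defs
begin

text \<open>
  A Fenchel conjugate is a supremum of continuous affine functions, hence convex and lower
  semicontinuous. For a unit vector \<open>x\<close> with \<open>m\<close> nonzero components, Cauchy-Schwarz on the support
  of \<open>x\<close> gives \<open>x \<bullet> y \<le> sgn_norm m y\<close>, so the conjugate at \<open>x\<close> is at most \<open>m\<close>. It is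
  at least \<open>m\<close> by testing with \<open>y = c *\<^sub>R x\<close> for large \<open>c\<close>: the value is the minimum over \<open>l\<close> of
  \<open>c * (1 - sgn_norm l x) + l\<close>, and \<open>sgn_norm l x < 1\<close> exactly when \<open>l < m\<close>.
\<close>

text \<open>The epigraph of a supremum is the intersection of the epigraphs.\<close>

lemma convex_ereal_SUP:
  assumes "\<And>i. i \<in> I \<Longrightarrow> convex_ereal (f i)"
  shows "convex_ereal (\<lambda>x. SUP i\<in>I. f i x)"
proof -
  have "{(x, t). (SUP i\<in>I. f i x) \<le> ereal t} = (\<Inter>i\<in>I. {(x, t). f i x \<le> ereal t})"
    by (auto simp: SUP_le_iff)
  then show ?thesis
    using assms unfolding convex_ereal_def by (simp add: convex_INT)
qed

text \<open>For finite \<open>c\<close> the epigraph is a half-space with normal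
  \<open>(y, - 1)\<close>; for infinite \<open>c\<close> the function is constantly infinite and its
  epigraph is empty or everything.\<close>

lemma convex_ereal_affine: "convex_ereal (\<lambda>x. ereal (x \<bullet> y) - c)"
proof (cases c)
  case (real r)
  have "{(x, t). ereal (x \<bullet> y) - c \<le> ereal t} = {p. (y, - 1) \<bullet> p \<le> r}"
    by (auto simp: real inner_Pair inner_commute)
  then show ?thesis
    by (simp add: convex_ereal_def convex_halfspace_le)
qed (simp_all add: convex_ereal_def)

lemma convex_ereal_fenchel_conjugate: "convex_ereal (fenchel_conjugate g)"
  unfolding fenchel_conjugate_def by (intro convex_ereal_SUP convex_ereal_affine)

lemma tendsto_ereal_affine:
  "((\<lambda>x. ereal (x \<bullet> y) - c) \<longlongrightarrow> ereal (a \<bullet> y) - c) (at a)"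
proof (cases c)
  case (real r)
  then show ?thesis by (auto intro!: tendsto_intros)
qed simp_all

text \<open>A strict lower bound at \<open>a\<close> is already exceeded by one affine minorant,
  whose continuity preserves the bound near \<open>a\<close>.\<close>

lemma lower_semicontinuous_fenchel_conjugate: "lower_semicontinuous (fenchel_conjugate g)"
  unfolding lower_semicontinuous_def le_Liminf_iff
proof (intro allI impI)
  fix a b
  assume "b < fenchel_conjugate g a"
  then obtain y where "b < ereal (a \<bullet> y) - g y"
    by (auto simp: fenchel_conjugate_def less_SUP_iff)
  then have "\<forall>\<^sub>F x in at a. b < ereal (x \<bullet> y) - g y"
    by (rule order_tendstoD(1)[OF tendsto_ereal_affine])
  then show "\<forall>\<^sub>F x in at a. b < fenchel_conjugate g x"
    by eventually_elim (auto simp: fenchel_conjugate_def less_SUP_iff)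
qed

lemma restrict_to_scaleR: "restrict_to K (c *\<^sub>R x) = c *\<^sub>R restrict_to K x"
  by (simp add: restrict_to_def vec_eq_iff)

lemma norm_restrict_to_le: "norm (restrict_to K x) \<le> norm x"
  by (rule norm_le_componentwise_cart) (simp add: restrict_to_def)

lemma norm_restrict_to_less:
  assumes "x $ i \<noteq> 0" "i \<notin> K"
  shows "norm (restrict_to K x) < norm x"
proof -
  have "restrict_to K x \<bullet> restrict_to K x < x \<bullet> x"
    unfolding inner_vec_def
    by (rule sum_strict_mono_ex1)
      (use assms in \<open>auto simp: restrict_to_def zero_less_mult_iff intro!: bexI[of _ i]\<close>)
  then show ?thesis by (simp add: norm_lt)
qed

lemma inner_le_norm_restrict_to:
  assumes "{i. x $ i \<noteq> 0} \<subseteq> K" "norm x \<le> 1"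
  shows "x \<bullet> y \<le> norm (restrict_to K y)"
proof -
  have "x \<bullet> y = x \<bullet> restrict_to K y"
    unfolding inner_vec_def by (rule sum.cong) (use assms(1) in \<open>auto simp: restrict_to_def\<close>)
  also have "\<dots> \<le> norm x * norm (restrict_to K y)"
    by (rule norm_cauchy_schwarz)
  also have "\<dots> \<le> norm (restrict_to K y)"
    using assms(2) by (simp add: mult_left_le_one_le)
  finally show ?thesis .
qed

lemma l0_le_CARD: "l0 (x::real^'n) \<le> CARD('n)"
  unfolding l0_def by (rule card_mono) auto

lemma sgn_norm_le:
  assumes "\<And>K. card K \<le> l \<Longrightarrow> norm (restrict_to K x) \<le> B"
  shows "sgn_norm l x \<le> B"
proof (cases "l = 0")
  case True
  \<comment> \<open>The value 0 at \<open>l = 0\<close> is a convention; the empty set shows that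
    \<open>B\<close> is nonnegative.\<close>
  have "norm (restrict_to {} x) \<le> B" by (rule assms) simp
  then have "0 \<le> B" by (meson norm_ge_zero order_trans)
  with True show ?thesis by (simp add: sgn_norm_def)
next
  case False
  have "{K::'a set. card K \<le> l} \<noteq> {}" by (auto intro: exI[of _ "{}"])
  with False assms show ?thesis by (auto simp: sgn_norm_def intro!: cSUP_least)
qed

lemma norm_restrict_to_le_sgn_norm:
  fixes x :: "real^'n"
  assumes "card K \<le> l"
  shows "norm (restrict_to K x) \<le> sgn_norm l x"
proof (cases "l = 0")
  case True
  with assms have "K = {}" by simp
  with True show ?thesis by (simp add: sgn_norm_def restrict_to_def vec_eq_iff)
next
  case False
  have "bdd_above ((\<lambda>K. norm (restrict_to K x)) ` {K. card K \<le> l})"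
    by (intro bdd_above_finite) simp
  with False assms show ?thesis by (auto simp: sgn_norm_def intro!: cSUP_upper)
qed

text \<open>A set smaller than the support misses a nonzero component, so the norm drops strictly.
  There are only finitely many such sets, hence the drop is uniform.\<close>

lemma norm_restrict_to_gap:
  fixes x :: "real^'n"
  shows "\<exists>\<delta>>0. \<forall>K. card K < l0 x \<longrightarrow> norm (restrict_to K x) \<le> norm x - \<delta>"
proof -
  \<comment> \<open>Inserting 1 keeps the set nonempty, with positive minimum, when
    \<open>x = 0\<close>.\<close>
  define A where "A = insert 1 ((\<lambda>K. norm x - norm (restrict_to K x)) ` {K. card K < l0 x})"
  have A: "finite A" "A \<noteq> {}" by (simp_all add: A_def)
  have "0 < norm x - norm (restrict_to K x)" if "card K < l0 x" for K
  proof -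
    have "\<not> {i. x $ i \<noteq> 0} \<subseteq> K"
      using that card_mono[of K "{i. x $ i \<noteq> 0}"] by (auto simp: l0_def)
    then show ?thesis using norm_restrict_to_less by auto
  qed
  then have "Min A > 0" using A by (auto simp: A_def)
  moreover have "norm (restrict_to K x) \<le> norm x - Min A" if "card K < l0 x" for K
  proof -
    have "Min A \<le> norm x - norm (restrict_to K x)"
      using that A(1) by (intro Min_le) (auto simp: A_def)
    then show ?thesis by simp
  qed
  ultimately show ?thesis by blast
qed

abbreviation sgn_norm_gap :: "real^'n \<Rightarrow> ereal" where
  "sgn_norm_gap y \<equiv> SUP l\<in>{0..CARD('n)}. ereal (sgn_norm l y - real l)"

lemma fenchel_conjugate_sgn_norm_gap_le:
  fixes x :: "real^'n"
  assumes "norm x \<le> 1"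
  shows "fenchel_conjugate sgn_norm_gap x \<le> ereal (real (l0 x))"
  unfolding fenchel_conjugate_def
proof (rule SUP_least)
  fix y :: "real^'n"
  have "x \<bullet> y \<le> norm (restrict_to {i. x $ i \<noteq> 0} y)"
    using assms by (intro inner_le_norm_restrict_to) auto
  also have "\<dots> \<le> sgn_norm (l0 x) y"
    by (rule norm_restrict_to_le_sgn_norm) (simp add: l0_def)
  finally have "ereal (x \<bullet> y - real (l0 x)) \<le> ereal (sgn_norm (l0 x) y - real (l0 x))"
    by simp
  also have "\<dots> \<le> sgn_norm_gap y"
    by (rule SUP_upper) (simp add: l0_le_CARD)
  finally show "ereal (x \<bullet> y) - sgn_norm_gap y \<le> ereal (real (l0 x))"
    \<comment> \<open>The value \<open>-\<infinity>\<close> contradicts the lower bound just shown;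
      the value \<open>\<infinity>\<close> makes the left side \<open>-\<infinity>\<close>.\<close>
    by (cases "sgn_norm_gap y") auto
qed

lemma fenchel_conjugate_sgn_norm_gap_ge:
  fixes x :: "real^'n"
  assumes "norm x = 1"
  shows "ereal (real (l0 x)) \<le> fenchel_conjugate sgn_norm_gap x"
proof -
  obtain \<delta> where \<delta>: "\<delta> > 0" "\<And>K. card K < l0 x \<Longrightarrow> norm (restrict_to K x) \<le> 1 - \<delta>"
    using norm_restrict_to_gap[of x] assms by auto
  \<comment> \<open>With this scale the gap \<delta> grows to exactly \<open>l0 x\<close>, which
    pays for every index below \<open>l0 x\<close>.\<close>
  define c where "c = real (l0 x) / \<delta>"
  have c: "c \<ge> 0" "c * \<delta> = real (l0 x)" using \<delta>(1) by (auto simp: c_def)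
  have "sgn_norm l (c *\<^sub>R x) - real l \<le> c - real (l0 x)" for l
  proof (cases "l < l0 x")
    case True
    have "sgn_norm l (c *\<^sub>R x) \<le> c * (1 - \<delta>)"
      using True \<delta>(2) c(1)
      by (intro sgn_norm_le) (auto simp: restrict_to_scaleR intro!: mult_left_mono)
    then show ?thesis using c(2) by (simp add: algebra_simps)
  next
    case False
    \<comment> \<open>From \<open>l0 x\<close> on, the trivial bound suffices, since the penalty
      \<open>l\<close> is large enough by itself.\<close>
    have "sgn_norm l (c *\<^sub>R x) \<le> c"
      using norm_restrict_to_le[of _ "c *\<^sub>R x"] assms c(1) by (intro sgn_norm_le) simp
    with False show ?thesis by simp
  qed
  then have "sgn_norm_gap (c *\<^sub>R x) \<le> ereal (c - real (l0 x))"
    by (intro SUP_least) simp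
  \<comment> \<open>As \<open>x\<close> is a unit vector, \<open>c\<close> is the inner product of
    \<open>x\<close> with the test point \<open>c *\<^sub>R x\<close>.\<close>
  then have "ereal c - ereal (c - real (l0 x)) \<le> ereal c - sgn_norm_gap (c *\<^sub>R x)"
    by (intro ereal_minus_mono) simp_all
  moreover have "x \<bullet> x = 1"
    using assms by (simp add: dot_square_norm)
  ultimately show ?thesis
    unfolding fenchel_conjugate_def by (intro SUP_upper2[of "c *\<^sub>R x"]) simp_all
qed

theorem corollary9:
  shows "let F = fenchel_conjugate
                   (\<lambda>y::real^'n. SUP l\<in>{0..CARD('n)}. ereal (sgn_norm l y - real l))
         in convex_ereal F \<and> lower_semicontinuous F \<and>
            (\<forall>x\<in>sphere 0 1. ereal (real (l0 x)) = F x)"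
  unfolding Let_def
  by (auto intro!: convex_ereal_fenchel_conjugate lower_semicontinuous_fenchel_conjugate antisym
      fenchel_conjugate_sgn_norm_gap_le fenchel_conjugate_sgn_norm_gap_ge)

end
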